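(* Let $X\in\mathbb{K}^{n\times n}$ be nonzero, put $\widehat{X}=X^*+\sigma(X)$, let $D$ be the matrix of singular values of $\widehat{X}$ and assume that $\sigma(D)$ is positive semi-definite. Let $\widehat{X}=UDV^*$ be an adapted singular value decomposition, that is, one for which $\Theta=U^*\sigma(V)$ verifies $\sigma(\Theta)=\Theta^*$. Let $\sigma'(Y)=\Theta\sigma(Y)\Theta^*$, and let $M$ and $M'$ be the symmetric spaces (Cartan models in $G$) associated to $\sigma$ and $\sigma'$ respectively. Assume $M=N$, where $N=\{B\in G:\sigma(B)=B^{-1}\}$. Then the point $A\in M$ is a critical point of $h_X^M$ if and only if $U^*AV\in M'$ is a critical point of $h_D^{M'}$.
   Context: Let $\mathbb{K}$ be one of $\mathbb{R}$, $\mathbb{C}$, $\mathbb{H}$ (quaternions). For $A\in\mathbb{K}^{n\times n}$, $A^*$ is its conjugate transpose. $G=O(n,\mathbb{K})=\{A\in\mathbb{K}^{n\times n}:AA^*=I\}$, i.e. $O(n)$, $U(n)$ or $Sp(n)$. $\sigma\colon\mathbb{K}^{n\times n}\to\mathbb{K}^{n\times n}$ is an involutive automorphism of unital (real) algebras satisfying $\sigma(Y^* )=\sigma(Y)^*$ for all $Y$; it restricts to an involutive automorphism of $G$. If $\Theta\in G$ satisfies $\sigma(\Theta)=\Theta^*$, then $\sigma'(Y)=\Theta\sigma(Y)\Theta^*$ is again such an involutive automorphism. For an automorphism $\tau$ of this kind with fixed point subgroup $K_\tau=\{B\in G:\tau(B)=B\}$, the associated symmetric space $G/K_\tau$ is identified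 with its Cartan model $\{B\tau(B)^{-1}:B\in G\}\subset G$, a submanifold of $G$ contained in $\{B\in G:\tau(B)=B^{-1}\}$. For $Z\in\mathbb{K}^{n\times n}$, $h_Z(Y)=\Re\operatorname{Tr}(ZY)$ (real part of the trace), and $h_Z^{M}$, $h_Z^{M'}$ are its restrictions to $M$, $M'$. For $Y\in\mathbb{K}^{n\times n}$, the matrix $YY^*$ is Hermitian positive-semidefinite with eigenvalues $0,t_1^2,\dots,t_k^2$ of multiplicities $n_0,\dots,n_k$, $0<t_1<\dots<t_k$, $n_0+\cdots+n_k=n$; the matrix of singular values of $Y$ is the real diagonal matrix $D$ with diagonal blocks $0_{n_0},t_1I_{n_1},\dots,t_kI_{n_k}$, and a singular value decomposition is $Y=UDV^*$ with $U,V\in O(n,\mathbb{K})$. *)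

theory Defs
  imports "HOL-Analysis.Analysis"
begin

section \<open>Quaternions\<close>

datatype quat = Quat (q0: real) (q1: real) (q2: real) (q3: real)

lemma quat_eq_iff: "x = y \<longleftrightarrow> q0 x = q0 y \<and> q1 x = q1 y \<and> q2 x = q2 y \<and> q3 x = q3 y"
  by (auto intro: quat.expand)

instantiation quat :: ring_1
begin

definition "0 = Quat 0 0 0 0"
definition "1 = Quat 1 0 0 0"
definition "x + y = Quat (q0 x + q0 y) (q1 x + q1 y) (q2 x + q2 y) (q3 x + q3 y)"
definition "- x = Quat (- q0 x) (- q1 x) (- q2 x) (- q3 x)"
definition "x - y = Quat (q0 x - q0 y) (q1 x - q1 y) (q2 x - q2 y) (q3 x - q3 y)"
definition "x * y = Quat
  (q0 x * q0 y - q1 x * q1 y - q2 x * q2 y - q3 x * q3 y)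
  (q0 x * q1 y + q1 x * q0 y + q2 x * q3 y - q3 x * q2 y)
  (q0 x * q2 y - q1 x * q3 y + q2 x * q0 y + q3 x * q1 y)
  (q0 x * q3 y + q1 x * q2 y - q2 x * q1 y + q3 x * q0 y)"

lemmas quat_ring_defs = zero_quat_def one_quat_def plus_quat_def uminus_quat_def
  minus_quat_def times_quat_def

instance
proof
  fix x y z :: quat
  show "x * y * z = x * (y * z)"
    unfolding times_quat_def quat.sel by (simp only: quat.inject) (intro conjI; simp add: algebra_simps)
  show "(x + y) * z = x * z + y * z" "x * (y + z) = x * y + x * z"
    unfolding times_quat_def plus_quat_def quat.sel
    by (simp_all only: quat.inject) (intro conjI; simp add: algebra_simps)+
qed (simp_all add: zero_quat_def one_quat_def plus_quat_def uminus_quat_def minus_quat_def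
      times_quat_def)

end

instantiation quat :: real_algebra_1
begin

definition "r *\<^sub>R x = Quat (r * q0 x) (r * q1 x) (r * q2 x) (r * q3 x)"

instance
  by standard (simp_all add: quat_ring_defs scaleR_quat_def algebra_simps)

end

definition qcnj :: "quat \<Rightarrow> quat" where
  "qcnj x = Quat (q0 x) (- q1 x) (- q2 x) (- q3 x)"

instantiation quat :: real_inner
begin

definition "inner x y = q0 x * q0 y + q1 x * q1 y + q2 x * q2 y + q3 x * q3 y"
definition "norm (x::quat) = sqrt (inner x x)"
definition "sgn (x::quat) = x /\<^sub>R norm x"
definition "dist (x::quat) y = norm (x - y)"
definition [code del]:
  "(uniformity :: (quat \<times> quat) filter) = (INF e\<in>{0 <..}. principal {(x, y). dist x y < e})"
definition [code del]:
  "open (U :: quat set) \<longleftrightarrow> (\<forall>x\<in>U. eventually (\<lambda>(x', y). x' = x \<longrightarrow> y \<in> U) uniformity)"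

instance
proof
  fix x y z :: quat and r :: real and S :: "quat set"
  show "dist x y = norm (x - y)" by (rule dist_quat_def)
  show "sgn x = x /\<^sub>R norm x" by (rule sgn_quat_def)
  show "uniformity = (INF e\<in>{0 <..}. principal {(x::quat, y). dist x y < e})"
    by (rule uniformity_quat_def)
  show "open S \<longleftrightarrow> (\<forall>x\<in>S. eventually (\<lambda>(x', y). x' = x \<longrightarrow> y \<in> S) uniformity)"
    by (rule open_quat_def)
  show "inner x y = inner y x"
    by (simp add: inner_quat_def mult.commute)
  show "inner (x + y) z = inner x z + inner y z"
    by (simp add: inner_quat_def plus_quat_def algebra_simps)
  show "inner (scaleR r x) y = r * inner x y"
    by (simp add: inner_quat_def scaleR_quat_def algebra_simps)
  show "0 \<le> inner x x"
    by (simp add: inner_quat_def)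
  show "inner x x = 0 \<longleftrightarrow> x = 0"
    by (simp add: inner_quat_def quat_eq_iff zero_quat_def add_nonneg_eq_0_iff)
  show "norm x = sqrt (inner x x)" by (rule norm_quat_def)
qed

end

instantiation quat :: euclidean_space
begin

definition "Basis = {Quat 1 0 0 0, Quat 0 1 0 0, Quat 0 0 1 0, Quat 0 0 0 1}"

instance
proof
  fix u v x :: quat
  show "(Basis :: quat set) \<noteq> {}" "finite (Basis :: quat set)"
    by (simp_all add: Basis_quat_def)
  show "(\<forall>u\<in>Basis. inner x u = 0) \<longleftrightarrow> x = 0"
    unfolding quat_eq_iff[of x] by (simp add: Basis_quat_def inner_quat_def zero_quat_def)
  assume "u \<in> Basis" "v \<in> Basis"
  then show "inner u v = (if u = v then 1 else 0)"
    unfolding Basis_quat_def inner_quat_def by (elim insertE emptyE) simp_all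
qed

end

instantiation quat :: real_normed_div_algebra
begin

definition "inverse (x::quat) = qcnj x /\<^sub>R inner x x"
definition "(x::quat) div y = x * inverse y"

instance
proof
  fix x y :: quat
  assume "x \<noteq> 0"
  then have nz: "inner x x \<noteq> 0" by simp
  have *: "qcnj x * x = inner x x *\<^sub>R 1" "x * qcnj x = inner x x *\<^sub>R 1"
    by (simp_all add: qcnj_def times_quat_def one_quat_def scaleR_quat_def inner_quat_def)
  show "inverse x * x = 1" "x * inverse x = 1"
    using nz by (simp_all add: inverse_quat_def *)
next
  show "inverse (0::quat) = 0"
    by (simp add: inverse_quat_def)
  show "x div y = x * inverse y" for x y :: quat
    by (rule divide_quat_def)
  show "norm (x * y) = norm x * norm y" for x y :: quat
  proof -
    have "inner (x * y) (x * y) = inner x x * inner y y"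
      by (simp add: inner_quat_def times_quat_def algebra_simps)
    then show ?thesis
      by (simp add: norm_quat_def real_sqrt_mult)
  qed
qed

end


section \<open>The scalars: real, complex or quaternionic\<close>

text \<open>
  The last axiom says that the structure is, up to isometric isomorphism of real algebras
  with conjugation, one of the three algebras \<open>\<real>\<close>, \<open>\<complex>\<close>, \<open>\<H>\<close>, seen inside the
  quaternions. The types \<^typ>\<open>real\<close>, \<^typ>\<open>complex\<close> and \<^typ>\<open>quat\<close> are instances.
\<close>

class rch = real_normed_div_algebra + euclidean_space +
  fixes kcnj :: "'a \<Rightarrow> 'a"
    and kre :: "'a \<Rightarrow> real"
  assumes rch_cases:
    "\<exists>\<phi> :: 'a \<Rightarrow> quat.
       (\<forall>x y. \<phi> (x + y) = \<phi> x + \<phi> y) \<and>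
       (\<forall>r x. \<phi> (scaleR r x) = scaleR r (\<phi> x)) \<and>
       (\<forall>x y. \<phi> (x * y) = \<phi> x * \<phi> y) \<and>
       \<phi> 1 = 1 \<and>
       (\<forall>x. norm (\<phi> x) = norm x) \<and>
       (\<forall>x. \<phi> (kcnj x) = qcnj (\<phi> x)) \<and>
       (\<forall>x. kre x = q0 (\<phi> x)) \<and>
       (range \<phi> = {q. q1 q = 0 \<and> q2 q = 0 \<and> q3 q = 0} \<or>
        range \<phi> = {q. q2 q = 0 \<and> q3 q = 0} \<or>
        range \<phi> = UNIV)"

instantiation real :: rch
begin

definition "kcnj (x::real) = x"
definition "kre (x::real) = x"

instance
  by (standard, rule exI[of _ "\<lambda>x. Quat x 0 0 0"])
    (auto simp: quat_ring_defs scaleR_quat_def norm_quat_def inner_quat_def qcnj_def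
      kcnj_real_def kre_real_def quat_eq_iff image_iff)

end

instantiation complex :: rch
begin

definition "kcnj (x::complex) = cnj x"
definition "kre (x::complex) = Re x"

lemma range_complex_quat: "range (\<lambda>x. Quat (Re x) (Im x) 0 0) = {q. q2 q = 0 \<and> q3 q = 0}"
proof (intro equalityI subsetI)
  fix q assume "q \<in> {q. q2 q = 0 \<and> q3 q = 0}"
  then have "q = Quat (Re (Complex (q0 q) (q1 q))) (Im (Complex (q0 q) (q1 q))) 0 0"
    by (simp add: quat_eq_iff)
  then show "q \<in> range (\<lambda>x. Quat (Re x) (Im x) 0 0)" by blast
qed auto

instance
  by (standard, rule exI[of _ "\<lambda>x. Quat (Re x) (Im x) 0 0"])
    (simp add: range_complex_quat quat_ring_defs scaleR_quat_def norm_quat_def inner_quat_def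
      qcnj_def kcnj_complex_def kre_complex_def cmod_def power2_eq_square)

end

instantiation quat :: rch
begin

definition "kcnj (x::quat) = qcnj x"
definition "kre (x::quat) = q0 x"

instance
  by (standard, intro exI[of _ "\<lambda>x. x"]) (simp add: kcnj_quat_def kre_quat_def)

end


section \<open>Matrices\<close>

type_synonym ('a, 'n) sqmat = "(('a, 'n) vec, 'n) vec"

definition adj :: "('a::rch)^'n^'m \<Rightarrow> 'a^'m^'n" where
  "adj A = (\<chi> i j. kcnj (A $ j $ i))"

definition O_group :: "(('a::rch, 'n::finite) sqmat) set" where
  "O_group = {A. A ** adj A = mat 1}"

definition psd :: "('a::rch, 'n::finite) sqmat \<Rightarrow> bool" where
  "psd A \<longleftrightarrow> adj A = A \<and> (\<forall>v. 0 \<le> kre (\<Sum>i\<in>UNIV. kcnj (v $ i) * (A *v v) $ i))"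

text \<open>
  The eigenspaces below are right vector spaces over the scalars, and \<^const>\<open>dim\<close> is
  the real dimension; hence the factor \<open>DIM('a)\<close>. The linear order on the index type
  stands for that of \<open>1, \<dots>, n\<close>.
\<close>

definition singular_value_matrix :: "('a::rch, 'n::{finite,linorder}) sqmat \<Rightarrow> ('a, 'n) sqmat \<Rightarrow> bool" where
  "singular_value_matrix Y D \<longleftrightarrow>
     (\<exists>d :: 'n \<Rightarrow> real.
        D = (\<chi> i j. if i = j then of_real (d i) else 0) \<and>
        mono d \<and> (\<forall>i. 0 \<le> d i) \<and>
        (\<forall>t\<ge>0. dim {v. (Y ** adj Y) *v v = t\<^sup>2 *\<^sub>R v} = DIM('a) * card {i. d i = t}))"

definition height :: "('a::rch, 'n::finite) sqmat \<Rightarrow> ('a, 'n) sqmat \<Rightarrow> real" where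
  "height Z Y = kre (trace (Z ** Y))"


section \<open>Involutions and symmetric spaces\<close>

definition star_involution :: "(('a::rch, 'n::finite) sqmat \<Rightarrow> ('a, 'n) sqmat) \<Rightarrow> bool" where
  "star_involution \<sigma> \<longleftrightarrow>
     linear \<sigma> \<and> \<sigma> (mat 1) = mat 1 \<and> (\<forall>Y Z. \<sigma> (Y ** Z) = \<sigma> Y ** \<sigma> Z) \<and>
     (\<forall>Y. \<sigma> (\<sigma> Y) = Y) \<and> (\<forall>Y. \<sigma> (adj Y) = adj (\<sigma> Y))"

definition cartan_model :: "(('a::rch, 'n::finite) sqmat \<Rightarrow> ('a, 'n) sqmat) \<Rightarrow> (('a, 'n) sqmat) set" where
  "cartan_model \<sigma> = {B ** matrix_inv (\<sigma> B) | B. B \<in> O_group}"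


section \<open>Critical points of functions on a submanifold\<close>

text \<open>\<open>c\<close> is \<open>C\<^sup>\<infinity>\<close> near \<open>0\<close> and stays in \<open>S\<close> there; \<open>F k\<close> is its \<open>k\<close>-th derivative.\<close>

definition smooth_curve_in :: "('a::real_normed_vector) set \<Rightarrow> (real \<Rightarrow> 'a) \<Rightarrow> bool" where
  "smooth_curve_in S c \<longleftrightarrow>
     (\<exists>e>0. \<exists>F :: nat \<Rightarrow> real \<Rightarrow> 'a.
        F 0 = c \<and>
        (\<forall>t\<in>{-e<..<e}. c t \<in> S \<and> (\<forall>k. (F k has_vector_derivative F (Suc k) t) (at t))))"

text \<open>
  For a submanifold \<open>S\<close> the tangent vectors at \<open>p\<close> are the velocities \<open>c'(0)\<close> of smooth curves
  in \<open>S\<close> with \<open>c(0) = p\<close>, and the differential of \<open>f|S\<close> at \<open>p\<close> maps \<open>c'(0)\<close> to \<open>(f \<circ> c)'(0)\<close>.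
\<close>

definition critical_point :: "('a::real_normed_vector) set \<Rightarrow> ('a \<Rightarrow> real) \<Rightarrow> 'a \<Rightarrow> bool" where
  "critical_point S f p \<longleftrightarrow>
     p \<in> S \<and> (\<forall>c. smooth_curve_in S c \<and> c 0 = p \<longrightarrow> ((f \<circ> c) has_real_derivative 0) (at 0))"

end

theory Submission
  imports Defs
begin

text \<open>
  Put \<open>L B = U\<^sup>* B V\<close>. The adaptedness condition says \<open>\<sigma>(V) \<sigma>(U)\<^sup>* = U V\<^sup>*\<close> and \<open>\<Theta> \<in> N = M\<close>, so
  \<open>\<Theta> = P \<sigma>(P)\<inverse>\<close> with \<open>P \<in> G\<close>; then \<open>L (B \<sigma>(B)\<inverse>) = C \<sigma>'(C)\<inverse>\<close> for \<open>C = U\<^sup>* B P\<^sup>*\<close>, whence \<open>L\<close> maps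
  \<open>M\<close> onto \<open>M'\<close>. Since \<open>Re Tr\<close> is a multiple of the real trace of left multiplication, it is invariant
  under every automorphism of the real algebra of matrices. Therefore \<open>h\<^sub>D (L B) = 2 h\<^sub>X B\<close> for
  \<open>B \<in> M\<close>, and the linear isomorphism \<open>L\<close> matches the critical points.
\<close>

section \<open>Conjugation and real part\<close>

text \<open>Packages a witness of \<open>rch_cases\<close>: an identity between scalars can then be
  checked in quaternion coordinates and pulled back by injectivity.\<close>

locale rch_embedding =
  fixes \<phi> :: "'a::rch \<Rightarrow> quat"
  assumes linear: "linear \<phi>"
    and mult: "\<phi> (x * y) = \<phi> x * \<phi> y"
    and one: "\<phi> 1 = 1"
    and norm: "norm (\<phi> x) = norm x"
    and kcnj: "\<phi> (kcnj x) = qcnj (\<phi> x)"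
    and kre: "kre x = q0 (\<phi> x)"
begin

lemmas add = linear_add[OF linear] and scaleR = linear_scale[OF linear]

lemma eq_iff: "\<phi> x = \<phi> y \<longleftrightarrow> x = y"
proof -
  have "inj \<phi>"
    unfolding linear_injective_0[OF linear] using norm by (metis norm_eq_zero)
  then show ?thesis
    by (simp add: inj_eq)
qed

text \<open>Polarization: a linear map preserving norms preserves inner products.\<close>

lemma inner: "\<phi> x \<bullet> \<phi> y = x \<bullet> y"
  by (simp add: dot_norm norm flip: add)

end

lemma rch_embedding_exists: "\<exists>\<phi> :: 'a::rch \<Rightarrow> quat. rch_embedding \<phi>"
proof -
  obtain \<phi> :: "'a \<Rightarrow> quat" where *: "\<forall>x y. \<phi> (x + y) = \<phi> x + \<phi> y" "\<forall>r x. \<phi> (scaleR r x) = scaleR r (\<phi> x)"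
    "\<forall>x y. \<phi> (x * y) = \<phi> x * \<phi> y" "\<phi> 1 = 1" "\<forall>x. norm (\<phi> x) = norm x"
    "\<forall>x. \<phi> (kcnj x) = qcnj (\<phi> x)" "\<forall>x. kre x = q0 (\<phi> x)"
    using rch_cases[where 'a='a] by (elim exE conjE) (rule that)
  have "rch_embedding \<phi>"
    by standard (use * in \<open>simp_all add: linear_iff\<close>)
  then show ?thesis
    by blast
qed

lemma qcnj_mult: "qcnj (x * y) = qcnj y * qcnj x"
  by (simp add: qcnj_def times_quat_def algebra_simps)

lemma linear_qcnj: "linear qcnj"
  by (rule linearI) (simp_all add: qcnj_def plus_quat_def scaleR_quat_def)

context rch_embedding
begin

lemma kcnj_kcnj: "kcnj (kcnj x) = x" for x :: 'a
  by (simp add: kcnj qcnj_def flip: eq_iff)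

lemma kcnj_mult: "kcnj (x * y) = kcnj y * kcnj x" for x y :: 'a
  by (simp add: kcnj mult qcnj_mult flip: eq_iff)

lemma linear_kcnj: "linear (kcnj :: 'a \<Rightarrow> 'a)"
  by (rule linearI)
    (simp_all add: kcnj add scaleR linear_add[OF linear_qcnj] linear_scale[OF linear_qcnj] flip: eq_iff)

lemma kcnj_of_real: "kcnj (of_real r) = (of_real r :: 'a)"
  by (simp add: kcnj of_real_def scaleR one qcnj_def one_quat_def scaleR_quat_def flip: eq_iff)

lemma linear_kre: "linear (kre :: 'a \<Rightarrow> real)"
  by (rule linearI) (simp_all add: kre add scaleR plus_quat_def scaleR_quat_def)

lemma kre_mult_commute: "kre (x * y) = kre (y * x)" for x y :: 'a
  by (simp add: kre mult times_quat_def)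

lemma kre_kcnj: "kre (kcnj x) = kre x" for x :: 'a
  by (simp add: kre kcnj qcnj_def)

text \<open>Left multiplication by an imaginary quaternion sends \<open>u\<close> to a vector
  orthogonal to \<open>u\<close>, so only the real part of \<open>y\<close> contributes.\<close>

lemma inner_mult_left_self: "(y * u) \<bullet> u = kre y * (u \<bullet> u)" for y u :: 'a
proof -
  have "(y * u) \<bullet> u = (\<phi> y * \<phi> u) \<bullet> \<phi> u"
    by (simp add: inner flip: mult)
  also have "\<dots> = q0 (\<phi> y) * (\<phi> u \<bullet> \<phi> u)"
    by (simp add: inner_quat_def times_quat_def algebra_simps)
  finally show ?thesis
    by (simp add: inner kre)
qed

end

text \<open>None of these statements mentions the embedding, so its mere existence frees them from
  the locale.\<close>

lemma
  fixes x y u :: "'a::rch"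
  shows kcnj_kcnj [simp]: "kcnj (kcnj x) = x"
    and kcnj_mult: "kcnj (x * y) = kcnj y * kcnj x"
    and linear_kcnj: "linear (kcnj :: 'a \<Rightarrow> 'a)"
    and kcnj_of_real [simp]: "kcnj (of_real r) = (of_real r :: 'a)"
    and linear_kre: "linear (kre :: 'a \<Rightarrow> real)"
    and kre_mult_commute: "kre (x * y) = kre (y * x)"
    and kre_kcnj [simp]: "kre (kcnj x) = kre x"
    and inner_mult_left_self: "(y * u) \<bullet> u = kre y * (u \<bullet> u)"
proof -
  obtain \<phi> :: "'a \<Rightarrow> quat" where "rch_embedding \<phi>"
    using rch_embedding_exists by blast
  then interpret rch_embedding \<phi> .
  show "kcnj (kcnj x) = x" by (rule kcnj_kcnj)
  show "kcnj (x * y) = kcnj y * kcnj x" by (rule kcnj_mult)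
  show "linear (kcnj :: 'a \<Rightarrow> 'a)" by (rule linear_kcnj)
  show "kcnj (of_real r) = (of_real r :: 'a)" by (rule kcnj_of_real)
  show "linear (kre :: 'a \<Rightarrow> real)" by (rule linear_kre)
  show "kre (x * y) = kre (y * x)" by (rule kre_mult_commute)
  show "kre (kcnj x) = kre x" by (rule kre_kcnj)
  show "(y * u) \<bullet> u = kre y * (u \<bullet> u)" by (rule inner_mult_left_self)
qed


section \<open>Matrices over the scalars\<close>

lemma adj_adj [simp]: "adj (adj A) = A"
  by (simp add: adj_def vec_eq_iff)

lemma adj_matrix_mult: "adj (A ** B) = adj B ** adj (A :: ('a::rch)^'n^'m)"
  by (simp add: adj_def matrix_matrix_mult_def vec_eq_iff linear_sum[OF linear_kcnj] kcnj_mult)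

lemma adj_mat_1 [simp]: "adj (mat 1) = (mat 1 :: ('a::rch, 'n::finite) sqmat)"
  using kcnj_of_real[where 'a='a, of 1] kcnj_of_real[where 'a='a, of 0]
  by (auto simp: adj_def mat_def vec_eq_iff)

lemma adj_add: "adj (A + B) = adj A + adj (B :: ('a::rch)^'n^'m)"
  by (simp add: adj_def vec_eq_iff linear_add[OF linear_kcnj])

lemma linear_matrix_mult_left:
  fixes A :: "('a::rch, 'n::finite) sqmat"
  shows "linear (\<lambda>Z :: ('a, 'n) sqmat. A ** Z)"
  by (rule linearI)
    (simp_all add: matrix_matrix_mult_def vec_eq_iff sum.distrib distrib_left scaleR_sum_right)

lemma linear_matrix_mult_right:
  fixes A :: "('a::rch, 'n::finite) sqmat"
  shows "linear (\<lambda>Z :: ('a, 'n) sqmat. Z ** A)"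
  by (rule linearI)
    (simp_all add: matrix_matrix_mult_def vec_eq_iff sum.distrib distrib_right scaleR_sum_right)

text \<open>A right inverse makes left multiplication by \<open>A\<close> surjective, hence
  injective on a finite-dimensional real space; and \<open>A ** (adj A ** A) = A\<close>. This
  avoids determinants, as the scalars may not commute.\<close>

lemma O_groupD:
  fixes A :: "('a::rch, 'n::finite) sqmat"
  assumes "A \<in> O_group"
  shows "A ** adj A = mat 1" "adj A ** A = mat 1"
proof -
  show 1: "A ** adj A = mat 1"
    using assms by (simp add: O_group_def)
  let ?f = "\<lambda>Z :: ('a, 'n) sqmat. A ** Z"
  have "surj ?f"
    by (rule surjI[of _ "\<lambda>Z. adj A ** Z"]) (simp add: matrix_mul_assoc 1)
  then have "inj ?f"
    by (rule linear_surjective_imp_injective[OF linear_matrix_mult_left]) (rule refl)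
  moreover have "?f (adj A ** A) = ?f (mat 1)"
    by (simp add: matrix_mul_assoc 1)
  ultimately show "adj A ** A = mat 1"
    by (rule injD)
qed

lemma O_group_cancel:
  fixes A B :: "('a::rch, 'n::finite) sqmat"
  assumes "A \<in> O_group"
  shows "B ** A ** adj A = B" "B ** adj A ** A = B"
  using O_groupD[OF assms] by (simp_all flip: matrix_mul_assoc)

lemma O_group_adj: "A \<in> O_group \<Longrightarrow> adj A \<in> O_group"
  using O_groupD(2) by (auto simp: O_group_def)

lemma O_group_mult:
  fixes A B :: "('a::rch, 'n::finite) sqmat"
  assumes "A \<in> O_group" "B \<in> O_group"
  shows "A ** B \<in> O_group"
proof -
  have "(A ** B) ** adj (A ** B) = A ** B ** adj B ** adj A"
    by (simp add: adj_matrix_mult matrix_mul_assoc)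
  then show ?thesis
    using O_groupD(1)[OF assms(1)] O_group_cancel(1)[OF assms(2)] by (simp add: O_group_def)
qed

lemma matrix_inv_O_group:
  assumes "A \<in> O_group"
  shows "matrix_inv A = adj A"
proof -
  \<comment> \<open>\<open>matrix_inv\<close> is a Hilbert choice; exhibiting a two-sided inverse
    makes the chosen matrix one too, and uniqueness does the rest.\<close>
  have "\<exists>B. A ** B = mat 1 \<and> B ** A = mat 1"
    using O_groupD[OF assms] by blast
  then have inv: "A ** matrix_inv A = mat 1 \<and> matrix_inv A ** A = mat 1"
    unfolding matrix_inv_def by (rule someI_ex)
  have "matrix_inv A = matrix_inv A ** (A ** adj A)"
    by (simp add: O_groupD[OF assms])
  also have "\<dots> = adj A"
    by (simp add: matrix_mul_assoc inv)
  finally show ?thesis .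
qed


section \<open>Invariance of the real trace\<close>

text \<open>Over the quaternions the trace itself is not cyclic, but its real part is, because
  \<open>kre (x * y) = kre (y * x)\<close>.\<close>

lemma kre_trace_mult_commute:
  "kre (trace (A ** B)) = kre (trace (B ** (A :: ('a::rch, 'n::finite) sqmat)))"
proof -
  have "kre (trace (A ** B)) = (\<Sum>i\<in>UNIV. \<Sum>j\<in>UNIV. kre (B $ j $ i * A $ i $ j))"
    by (simp add: trace_def matrix_matrix_mult_def linear_sum[OF linear_kre] kre_mult_commute)
  also have "\<dots> = kre (trace (B ** A))"
    by (subst sum.swap) (simp add: trace_def matrix_matrix_mult_def linear_sum[OF linear_kre])
  finally show ?thesis .
qed

lemma kre_trace_adj: "kre (trace (adj A)) = kre (trace (A :: ('a::rch, 'n::finite) sqmat))"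
  by (simp add: trace_def adj_def linear_sum[OF linear_kre])

text \<open>For linear \<open>f\<close> this is the usual trace of a real endomorphism, read off in
  the standard orthonormal basis.\<close>

definition op_trace :: "('a::euclidean_space \<Rightarrow> 'a) \<Rightarrow> real" where
  "op_trace f = (\<Sum>b\<in>Basis. f b \<bullet> b)"

lemma op_trace_comp_commute:
  fixes f g :: "'a::euclidean_space \<Rightarrow> 'a"
  assumes "linear f" "linear g"
  shows "op_trace (f \<circ> g) = op_trace (g \<circ> f)"
proof -
  have expand: "op_trace (p \<circ> q) = (\<Sum>b\<in>Basis. \<Sum>c\<in>Basis. (q b \<bullet> c) * (p c \<bullet> b))"
    if "linear p" for p q :: "'a \<Rightarrow> 'a"
  proof -
    have "p (q b) \<bullet> b = (\<Sum>c\<in>Basis. (q b \<bullet> c) * (p c \<bullet> b))" for b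
    proof -
      have "p (q b) = p (\<Sum>c\<in>Basis. (q b \<bullet> c) *\<^sub>R c)"
        by (simp add: euclidean_representation)
      then show ?thesis
        by (simp add: linear_sum[OF that] linear_scale[OF that] inner_sum_left)
    qed
    then show ?thesis
      by (simp add: op_trace_def)
  qed
  show ?thesis
    by (subst expand[OF assms(2)], subst sum.swap) (simp add: expand[OF assms(1)] mult.commute)
qed

text \<open>Applied twice, this indexes the real basis of the matrix space by row, column and scalar
  basis element.\<close>

lemma sum_Basis_vec:
  fixes f :: "('b::euclidean_space)^'n \<Rightarrow> 'c::comm_monoid_add"
  shows "sum f Basis = (\<Sum>i\<in>UNIV. \<Sum>u\<in>Basis. f (axis i u))"
proof -
  let ?g = "\<lambda>(i, u). axis i u" and ?B = "(UNIV :: 'n set) \<times> (Basis :: 'b set)"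
  have inj: "inj_on ?g ?B"
    by (auto simp: inj_on_def axis_eq_axis)
  have "sum f Basis = sum f (?g ` ?B)"
    by (rule arg_cong[of _ _ "sum f"]) (auto simp: Basis_vec_def)
  also have "\<dots> = sum (f \<circ> ?g) ?B"
    by (rule sum.reindex[OF inj])
  finally show ?thesis
    by (simp add: sum.cartesian_product o_def case_prod_unfold)
qed

text \<open>For the matrix with sole entry \<open>u\<close> at position (i,j), the product with
  \<open>Y\<close> has entry \<open>Y $ i $ i * u\<close> there. The contribution
  \<open>kre (Y $ i $ i)\<close> is independent of j and \<open>u\<close>, whence the
  factor.\<close>

lemma op_trace_matrix_mult:
  fixes Y :: "('a::rch, 'n::finite) sqmat"
  shows "op_trace (\<lambda>Z :: ('a, 'n) sqmat. Y ** Z) = real (CARD('n) * DIM('a)) * kre (trace Y)"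
proof -
  have entry: "(Y ** axis i (axis j u)) \<bullet> axis i (axis j u) = kre (Y $ i $ i)" if "u \<in> Basis"
    for i j :: 'n and u :: 'a
  proof -
    have "(Y ** axis i (axis j u)) $ i $ j = (\<Sum>k\<in>UNIV. if k = i then Y $ i $ i * u else 0)"
      unfolding matrix_matrix_mult_def vec_lambda_beta by (rule sum.cong) (auto simp: axis_def)
    also have "\<dots> = Y $ i $ i * u"
      by simp
    finally show ?thesis
      using that by (simp add: inner_axis inner_mult_left_self)
  qed
  have "op_trace (\<lambda>Z :: ('a, 'n) sqmat. Y ** Z)
      = (\<Sum>i::'n\<in>UNIV. \<Sum>j::'n\<in>UNIV. \<Sum>u::'a\<in>Basis. kre (Y $ i $ i))"
    by (simp add: op_trace_def sum_Basis_vec entry cong: sum.cong)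
  then show ?thesis
    by (simp add: trace_def linear_sum[OF linear_kre] sum_distrib_left mult.assoc)
qed

text \<open>Left multiplication by \<open>\<sigma> Y\<close> is the conjugate by
  \<open>\<sigma>\<close> of left multiplication by \<open>Y\<close>, and conjugate endomorphisms
  have equal traces.\<close>

lemma kre_trace_star_involution:
  fixes \<sigma> :: "('a::rch, 'n::finite) sqmat \<Rightarrow> ('a, 'n) sqmat"
  assumes "star_involution \<sigma>"
  shows "kre (trace (\<sigma> Y)) = kre (trace Y)"
proof -
  have lin: "linear \<sigma>" and mult: "\<And>Y Z. \<sigma> (Y ** Z) = \<sigma> Y ** \<sigma> Z" and inv: "\<And>Y. \<sigma> (\<sigma> Y) = Y"
    using assms by (auto simp: star_involution_def)
  let ?L = "\<lambda>Y Z :: ('a, 'n) sqmat. Y ** Z"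
  have "?L (\<sigma> Y) = (\<sigma> \<circ> ?L Y) \<circ> \<sigma>"
    by (auto simp: mult inv)
  then have "op_trace (?L (\<sigma> Y)) = op_trace (\<sigma> \<circ> (\<sigma> \<circ> ?L Y))"
    by (simp only: op_trace_comp_commute[OF linear_compose[OF linear_matrix_mult_left lin] lin])
  also have "\<sigma> \<circ> (\<sigma> \<circ> ?L Y) = ?L Y"
    by (auto simp: inv)
  finally show ?thesis
    by (simp add: op_trace_matrix_mult)
qed


section \<open>Transport of critical points\<close>

lemma smooth_curve_in_linear_image:
  assumes "bounded_linear L" "\<And>B. B \<in> S \<Longrightarrow> L B \<in> S'" "smooth_curve_in S c"
  shows "smooth_curve_in S' (L \<circ> c)"
proof -
  obtain e F where e: "e > 0" and F: "F 0 = c"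
    "\<And>t. t \<in> {-e<..<e} \<Longrightarrow> c t \<in> S \<and> (\<forall>k. (F k has_vector_derivative F (Suc k) t) (at t))"
    using assms(3) unfolding smooth_curve_in_def by blast
  show ?thesis
    unfolding smooth_curve_in_def
  proof (intro exI[of _ e] exI[of _ "\<lambda>k. L \<circ> F k"] conjI ballI allI)
    fix t k assume t: "t \<in> {-e<..<e}"
    show "(L \<circ> c) t \<in> S'"
      using F(2)[OF t] assms(2) by simp
    show "(L \<circ> F k has_vector_derivative (L \<circ> F (Suc k)) t) (at t)"
      using bounded_linear.has_vector_derivative[OF assms(1)] F(2)[OF t] by (auto simp: o_def)
  qed (use e F(1) in auto)
qed

text \<open>\<open>L\<close> carries curves through \<open>p\<close> to curves through
  \<open>L p\<close>, along which \<open>g\<close> has derivative 0. Stated one way only, it will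
  serve once for a bijection and once for its inverse.\<close>

lemma critical_point_linear_pullback:
  assumes L: "bounded_linear L" "\<And>B. B \<in> S \<Longrightarrow> L B \<in> S'"
    and f: "\<And>B. B \<in> S \<Longrightarrow> f B = a * g (L B)"
    and p: "p \<in> S" "critical_point S' g (L p)"
  shows "critical_point S f p"
  unfolding critical_point_def
proof (intro conjI allI impI)
  fix c assume c: "smooth_curve_in S c \<and> c 0 = p"
  then obtain e where e: "e > 0" "\<And>t. t \<in> {-e<..<e} \<Longrightarrow> c t \<in> S"
    unfolding smooth_curve_in_def by blast
  have "smooth_curve_in S' (L \<circ> c)"
    using smooth_curve_in_linear_image[OF L] c by blast
  then have "((g \<circ> (L \<circ> c)) has_real_derivative 0) (at 0)"
    using p(2) c by (auto simp: critical_point_def)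
  then have "((\<lambda>t. a * (g \<circ> (L \<circ> c)) t) has_real_derivative 0) (at 0)"
    using DERIV_cmult by fastforce
  \<comment> \<open>The relation between \<open>f\<close> and \<open>g\<close> holds only on
    \<open>S\<close>, so the derivative is transferred on the interval where \<open>c\<close> stays
    in \<open>S\<close>.\<close>
  then show "((f \<circ> c) has_real_derivative 0) (at 0)"
    by (rule has_field_derivative_transform_within_open[of _ _ _ "{-e<..<e}"])
      (use e f in auto)
qed (fact p(1))


section \<open>Adapted singular value decompositions\<close>

lemma star_involution_O_group:
  assumes "star_involution \<sigma>" "B \<in> O_group"
  shows "\<sigma> B \<in> O_group"
proof -
  have "\<sigma> B ** adj (\<sigma> B) = \<sigma> (B ** adj B)"
    using assms(1) by (simp add: star_involution_def)
  also have "\<dots> = mat 1"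
    using assms(1) by (simp add: O_groupD(1)[OF assms(2)] star_involution_def)
  finally show ?thesis
    by (simp add: O_group_def)
qed

lemma cartan_model_iff:
  assumes "\<And>C. C \<in> O_group \<Longrightarrow> \<tau> C \<in> O_group"
  shows "B \<in> cartan_model \<tau> \<longleftrightarrow> (\<exists>C\<in>O_group. B = C ** adj (\<tau> C))"
proof -
  have "matrix_inv (\<tau> C) = adj (\<tau> C)" if "C \<in> O_group" for C
    using matrix_inv_O_group assms that by blast
  then show ?thesis
    unfolding cartan_model_def by (simp add: Bex_def) metis
qed

theorem proposition6p2:
  fixes X Xhat D U V \<Theta> A :: "('a::rch, 'n::{finite,linorder}) sqmat"
    and \<sigma> \<sigma>' :: "('a, 'n) sqmat \<Rightarrow> ('a, 'n) sqmat"
    and M M' N :: "(('a, 'n) sqmat) set"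
  assumes "star_involution \<sigma>"
    and "X \<noteq> 0"
    and "Xhat = adj X + \<sigma> X"
    and "singular_value_matrix Xhat D"
    and "psd (\<sigma> D)"
    and "U \<in> O_group" and "V \<in> O_group"
    and "Xhat = U ** D ** adj V"
    and "\<Theta> = adj U ** \<sigma> V"
    and "\<sigma> \<Theta> = adj \<Theta>"
    and "\<sigma>' = (\<lambda>Y. \<Theta> ** \<sigma> Y ** adj \<Theta>)"
    and "M = cartan_model \<sigma>"
    and "M' = cartan_model \<sigma>'"
    and "N = {B \<in> O_group. \<sigma> B = matrix_inv B}"
    and "M = N"
    and "A \<in> M"
  shows "adj U ** A ** V \<in> M' \<and>
    (critical_point M (height X) A \<longleftrightarrow> critical_point M' (height D) (adj U ** A ** V))"
proof -
  have mult: "\<And>Y Z. \<sigma> (Y ** Z) = \<sigma> Y ** \<sigma> Z" and inv: "\<And>Y. \<sigma> (\<sigma> Y) = Y"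
    and adj: "\<And>Y. \<sigma> (adj Y) = adj (\<sigma> Y)"
    using assms(1) by (auto simp: star_involution_def)
  note \<sigma>O = star_involution_O_group[OF assms(1)]
  note U = \<open>U \<in> O_group\<close> and V = \<open>V \<in> O_group\<close>
  note cancel = O_group_cancel O_groupD
  have \<Theta>: "\<Theta> \<in> O_group"
    using U V by (simp add: assms(9) O_group_mult O_group_adj \<sigma>O)

  \<comment> \<open>Both Cartan models in explicit form, and the adaptedness condition\<close>
  have M: "B \<in> M \<longleftrightarrow> (\<exists>C\<in>O_group. B = C ** adj (\<sigma> C))" for B
    unfolding assms(12) by (rule cartan_model_iff) (rule \<sigma>O)
  have M': "B \<in> M' \<longleftrightarrow> (\<exists>C\<in>O_group. B = C ** \<Theta> ** adj (\<sigma> C) ** adj \<Theta>)" for B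
    unfolding assms(13)
    by (subst cartan_model_iff)
      (auto simp: assms(11) \<sigma>O \<Theta> O_group_mult O_group_adj adj_matrix_mult matrix_mul_assoc)
  have "\<Theta> \<in> M"
    using \<Theta> assms(10) by (simp add: assms(14,15) matrix_inv_O_group)
  then obtain P where P: "P \<in> O_group" "\<Theta> = P ** adj (\<sigma> P)"
    using M by blast
  \<comment> \<open>The two sides are \<open>\<sigma> \<Theta>\<close> and
    \<open>adj \<Theta>\<close>.\<close>
  have "adj (\<sigma> U) ** V = adj (\<sigma> V) ** U"
    using assms(10) by (simp add: assms(9) mult adj inv adj_matrix_mult)
  then have "\<sigma> V ** (adj (\<sigma> U) ** V) ** adj V = \<sigma> V ** (adj (\<sigma> V) ** U) ** adj V"
    by simp
  then have "\<sigma> V ** adj (\<sigma> U) = U ** adj V"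
    using U V by (simp add: matrix_mul_assoc cancel \<sigma>O)
  from arg_cong[OF this, of adj] have VU: "\<sigma> U ** adj (\<sigma> V) = V ** adj U"
    by (simp add: adj_matrix_mult)

  \<comment> \<open>The bijection between \<open>M\<close> and \<open>M'\<close>\<close>
  define L where "L B = adj U ** B ** V" for B
  define L' where "L' B = U ** B ** adj V" for B
  have L'L: "L' (L B) = B" and LL': "L (L' B) = B" for B
    using U V by (simp_all add: L_def L'_def matrix_mul_assoc cancel)
  \<comment> \<open>The factor \<open>adj P\<close> in \<open>C\<close> absorbs the \<open>P\<close>
    of \<open>\<Theta>\<close>. What remains of \<open>P\<close> cancels in the middle, and
    \<open>VU\<close> turns the right end into \<open>V\<close>.\<close>
  have key: "L (B ** adj (\<sigma> B)) = C ** \<Theta> ** adj (\<sigma> C) ** adj \<Theta>"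
    if "B \<in> O_group" "C = adj U ** B ** adj P" for B C
  proof -
    have "C ** \<Theta> = adj U ** B ** adj (\<sigma> P)"
      using P(1) by (simp add: that(2) P(2) matrix_mul_assoc cancel)
    moreover have "adj (\<sigma> C) = \<sigma> P ** adj (\<sigma> B) ** \<sigma> U"
      by (simp add: that(2) mult adj adj_matrix_mult matrix_mul_assoc)
    moreover have "adj \<Theta> = adj (\<sigma> V) ** U"
      by (simp add: assms(9) adj_matrix_mult)
    ultimately have "C ** \<Theta> ** adj (\<sigma> C) ** adj \<Theta>
        = adj U ** B ** adj (\<sigma> P) ** \<sigma> P ** adj (\<sigma> B) ** (\<sigma> U ** adj (\<sigma> V)) ** U"
      by (simp add: matrix_mul_assoc)
    also have "\<dots> = L (B ** adj (\<sigma> B))"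
      unfolding VU using U P(1) by (simp add: L_def matrix_mul_assoc cancel \<sigma>O)
    finally show ?thesis by simp
  qed
  have LM: "L B \<in> M'" if B: "B \<in> M" for B
  proof -
    obtain C where C: "C \<in> O_group" "B = C ** adj (\<sigma> C)"
      using B unfolding M by blast
    let ?E = "adj U ** C ** adj P"
    have "?E \<in> O_group"
      using C U P by (simp add: O_group_mult O_group_adj)
    moreover have "L B = ?E ** \<Theta> ** adj (\<sigma> ?E) ** adj \<Theta>"
      unfolding C(2) by (rule key[OF C(1) refl])
    ultimately show ?thesis
      unfolding M' by (rule bexI[rotated])
  qed
  have L'M: "L' B \<in> M" if B: "B \<in> M'" for B
  proof -
    obtain C where C: "C \<in> O_group" "B = C ** \<Theta> ** adj (\<sigma> C) ** adj \<Theta>"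
      using B unfolding M' by blast
    \<comment> \<open>Obtained by solving \<open>C = adj U ** E ** adj P\<close> for
      \<open>E\<close>.\<close>
    let ?E = "U ** C ** P"
    have E: "?E \<in> O_group"
      using C U P by (simp add: O_group_mult)
    have "C = adj U ** ?E ** adj P"
      using U P by (simp add: matrix_mul_assoc cancel)
    then have "L (?E ** adj (\<sigma> ?E)) = B"
      using key[OF E] C(2) by simp
    then have "L' B = ?E ** adj (\<sigma> ?E)"
      using L'L by metis
    then show ?thesis
      unfolding M using E by (rule bexI)
  qed

  \<comment> \<open>Comparison of the height functions\<close>
  have D: "adj D = D"
    using assms(4) kcnj_of_real[where 'a='a, of 0]
    by (auto simp: singular_value_matrix_def adj_def vec_eq_iff)
  have hL: "height D (L B) = 2 * height X B" if "B \<in> M" for B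
  proof -
    have B: "\<sigma> B = adj B"
      using that by (auto simp: assms(14,15) matrix_inv_O_group)
    have "height D (L B) = kre (trace (D ** adj U ** B ** V))"
      by (simp add: height_def L_def matrix_mul_assoc)
    also have "\<dots> = kre (trace (V ** (D ** adj U ** B)))"
      by (rule kre_trace_mult_commute)
    also have "V ** (D ** adj U ** B) = adj Xhat ** B"
      by (simp add: assms(8) adj_matrix_mult D matrix_mul_assoc)
    \<comment> \<open>Here \<open>B \<in> M\<close> enters: \<open>B = \<sigma> (adj B)\<close> puts
      the second summand under \<open>\<sigma>\<close>. Invariance of the real trace then makes it
      equal to the first, which gives the factor 2.\<close>
    also have "\<dots> = X ** B + \<sigma> (adj X ** adj B)"
      by (simp add: assms(3) adj_add adj mult B[symmetric] inv linear_add[OF linear_matrix_mult_right])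
    also have "kre (trace \<dots>) = kre (trace (X ** B)) + kre (trace (\<sigma> (adj X ** adj B)))"
      by (simp add: trace_def sum.distrib linear_add[OF linear_kre])
    also have "kre (trace (\<sigma> (adj X ** adj B))) = kre (trace (adj (B ** X)))"
      by (simp add: kre_trace_star_involution[OF assms(1)] adj_matrix_mult)
    also have "\<dots> = kre (trace (X ** B))"
      by (simp only: kre_trace_adj kre_trace_mult_commute[of B])
    finally show ?thesis
      by (simp add: height_def)
  qed
  have hL': "height D B = 2 * height X (L' B)" if "B \<in> M'" for B
    using hL[OF L'M[OF that]] by (simp add: LL')

  have bilinear: "bounded_linear (\<lambda>B. Y ** B ** Z)" for Y Z :: "('a, 'n) sqmat"
    using linear_compose[OF linear_matrix_mult_left[of Y] linear_matrix_mult_right[of Z]]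
    by (simp add: linear_conv_bounded_linear o_def)
  have bl: "bounded_linear L" "bounded_linear L'"
    unfolding L_def[abs_def] L'_def[abs_def] by (rule bilinear)+

  have LA: "L A \<in> M'"
    by (rule LM) fact
  \<comment> \<open>The forward direction pulls back along \<open>L'\<close> with factor 2, the
    converse along \<open>L\<close> with factor 1/2.\<close>
  have "critical_point M (height X) A \<longleftrightarrow> critical_point M' (height D) (L A)"
  proof
    assume "critical_point M (height X) A"
    then show "critical_point M' (height D) (L A)"
      by (intro critical_point_linear_pullback[where f = "height D" and g = "height X" and a = 2, OF bl(2) L'M hL' LA])
        (simp_all add: L'L)
  next
    assume "critical_point M' (height D) (L A)"
    then show "critical_point M (height X) A"
      by (intro critical_point_linear_pullback[where f = "height X" and g = "height D" and a = "1/2", OF bl(1) LM _ \<open>A \<in> M\<close>])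
        (simp_all add: hL)
  qed
  with LA show ?thesis
    by (simp add: L_def)
qed

end
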